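(* Let $\mathcal S^*=\mathcal S^*(\varphi_0)$ with $\varphi_0(z)=\dfrac{1+z}{1-z}$ be the full starlike class, and let $\varphi_L(z)=\sqrt{1+z}$ (principal branch), $z\in\mathbb D$. Then $$R_{\mathcal S^*(\varphi_L)}(\mathcal S^* )=3-2\sqrt2.$$
   Context: Let $\mathbb D=\{z\in\mathbb C:|z|<1\}$ and let $\mathcal A$ be the class of functions $f$ analytic on $\mathbb D$ with $f(0)=0$ and $f'(0)=1$. For an analytic function $\varphi$ on $\mathbb D$ with $\varphi(0)=1$, the class $\mathcal S^*(\varphi)$ consists of all $f\in\mathcal A$ with $zf'(z)/f(z)\prec\varphi(z)$; that is, there is an analytic $\omega:\mathbb D\to\mathbb D$ with $\omega(0)=0$ such that $zf'(z)/f(z)=\varphi(\omega(z))$ on $\mathbb D$ (the quotient takes the value $1$ at $z=0$, and $f$ has no other zeros). For two such functions $\varphi_1,\varphi_2$, the sharp $\mathcal S^*(\varphi_2)$-radius of $\mathcal S^*(\varphi_1)$ is $$R_{\mathcal S^*(\varphi_2)}(\mathcal S^*(\varphi_1))=\sup\left\{r\in(0,1]: f_r(z)=\tfrac{f(rz)}{r}\text{ belongs to }\mathcal S^*(\varphi_2)\text{ for every } f\in\mathcal S^*(\varphi_1)\right\}.$$ *)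

theory Defs
  imports "HOL-Complex_Analysis.Complex_Analysis"
begin

abbreviation unit_disc :: "complex set" where
  "unit_disc \<equiv> ball 0 1"

(* Functions on the disc are represented by total functions complex => complex; all the
   notions below depend only on their values on unit_disc. *)

definition class_A :: "(complex \<Rightarrow> complex) set" where
  "class_A = {f. f holomorphic_on unit_disc \<and> f 0 = 0 \<and> deriv f 0 = 1}"

definition subordinate :: "(complex \<Rightarrow> complex) \<Rightarrow> (complex \<Rightarrow> complex) \<Rightarrow> bool" where
  "subordinate g h \<longleftrightarrow>
     (\<exists>\<omega>. \<omega> holomorphic_on unit_disc \<and> \<omega> ` unit_disc \<subseteq> unit_disc \<and> \<omega> 0 = 0 \<and>
          (\<forall>z\<in>unit_disc. g z = h (\<omega> z)))"

(* The value 1 at the origin is the removable value of z f'(z) / f(z) for f in class_A. *)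
definition starlike_quotient :: "(complex \<Rightarrow> complex) \<Rightarrow> complex \<Rightarrow> complex" where
  "starlike_quotient f z = (if z = 0 then 1 else z * deriv f z / f z)"

(* Since x / 0 = 0 in HOL, the absence of zeros other than the origin is required explicitly. *)
definition starlike_class :: "(complex \<Rightarrow> complex) \<Rightarrow> (complex \<Rightarrow> complex) set" where
  "starlike_class \<phi> =
     {f \<in> class_A. (\<forall>z\<in>unit_disc - {0}. f z \<noteq> 0) \<and> subordinate (starlike_quotient f) \<phi>}"

definition class_radius :: "(complex \<Rightarrow> complex) \<Rightarrow> (complex \<Rightarrow> complex) \<Rightarrow> real" where
  "class_radius \<phi>2 \<phi>1 =
     Sup {r::real. 0 < r \<and> r \<le> 1 \<and>
       (\<forall>f\<in>starlike_class \<phi>1.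
          (\<lambda>z. f (complex_of_real r * z) / complex_of_real r) \<in> starlike_class \<phi>2)}"

definition phi_0 :: "complex \<Rightarrow> complex" where
  "phi_0 z = (1 + z) / (1 - z)"

definition phi_L :: "complex \<Rightarrow> complex" where
  "phi_L z = csqrt (1 + z)"

lemma phi_0_admissible: "phi_0 holomorphic_on unit_disc" "phi_0 0 = 1"
  unfolding phi_0_def by (auto intro!: holomorphic_intros)

lemma phi_L_admissible: "phi_L holomorphic_on unit_disc" "phi_L 0 = 1"
proof -
  have "1 + z \<notin> \<real>\<^sub>\<le>\<^sub>0" if "z \<in> unit_disc" for z
  proof -
    have "\<bar>Re z\<bar> < 1"
      using abs_Re_le_cmod[of z] that by simp
    then show ?thesis
      by (auto simp: complex_nonpos_Reals_iff)
  qed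
  then show "phi_L holomorphic_on unit_disc"
    unfolding phi_L_def by (intro holomorphic_intros) auto
qed (simp add: phi_L_def)

end

theory Submission
  imports Defs
begin

text \<open>
  With \<open>w = (1 + \<omega>) / (1 - \<omega>)\<close> one has \<open>w\<^sup>2 - 1 = 4 \<omega> / (1 - \<omega>)\<^sup>2\<close>, while \<open>w\<close> has the form
  \<open>csqrt (1 + \<zeta>)\<close> with \<open>\<zeta>\<close> in the disc iff \<open>Re w > 0\<close> and \<open>\<zeta> = w\<^sup>2 - 1\<close> has modulus below 1.
  By Schwarz's lemma \<open>\<omega>\<close> may be bounded by \<open>r\<close> on the disc of radius \<open>r\<close>, so the condition is
  \<open>4 r \<le> (1 - r)\<^sup>2\<close>, whose critical value is \<open>3 - 2 \<surd>2\<close>. The Koebe function, for which \<open>\<omega>\<close>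
  is the identity, shows that nothing better is possible.
\<close>

lemma deriv_rescale:
  assumes "f field_differentiable at (c * z)" "c \<noteq> 0"
  shows "((\<lambda>z. f (c * z) / c) has_field_derivative deriv f (c * z)) (at z)"
proof -
  have "(f has_field_derivative deriv f (c * z)) (at (c * z))"
    using assms(1) by (simp add: DERIV_deriv_iff_field_differentiable)
  moreover have "((\<lambda>z. c * z) has_field_derivative c) (at z)"
    by (auto intro!: derivative_eq_intros)
  ultimately have "((\<lambda>z. f (c * z)) has_field_derivative deriv f (c * z) * c) (at z)"
    by (rule DERIV_chain2)
  then have "((\<lambda>z. f (c * z) / c) has_field_derivative deriv f (c * z) * c / c) (at z)"
    by (rule DERIV_cdivide)
  then show ?thesis
    using assms(2) by simp
qed

lemma mult_mem_unit_disc: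
  assumes "0 < r" "r \<le> 1" "z \<in> unit_disc"
  shows "complex_of_real r * z \<in> unit_disc"
proof -
  have "r * cmod z \<le> 1 * cmod z"
    using assms by (intro mult_right_mono) auto
  then show ?thesis
    using assms by (simp add: norm_mult)
qed

text \<open>The factor r from the chain rule cancels against the division by r, so rescaling merely
  evaluates the quotient of \<open>f\<close> on a smaller disc. At the origin both quotients take
  the default value 1.\<close>

lemma rescale_class_A:
  assumes "f \<in> class_A" "0 < r" "r \<le> 1"
  shows "(\<lambda>z. f (complex_of_real r * z) / complex_of_real r) \<in> class_A"
    and "\<And>z. z \<in> unit_disc \<Longrightarrow>
      starlike_quotient (\<lambda>z. f (complex_of_real r * z) / complex_of_real r) z =
      starlike_quotient f (complex_of_real r * z)"
proof -
  let ?g = "\<lambda>z. f (complex_of_real r * z) / complex_of_real r"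
  have der: "(?g has_field_derivative deriv f (complex_of_real r * z)) (at z)"
    if "z \<in> unit_disc" for z
  proof (rule deriv_rescale)
    show "f field_differentiable at (complex_of_real r * z)"
      using assms mult_mem_unit_disc[OF _ _ that]
      by (auto simp: class_A_def intro: holomorphic_on_imp_differentiable_at)
  qed (use assms in auto)
  have "?g holomorphic_on unit_disc"
    using der by (subst holomorphic_on_open) blast+
  moreover have "deriv ?g 0 = deriv f 0"
    using DERIV_imp_deriv[OF der[of 0]] by simp
  ultimately show "?g \<in> class_A"
    using assms by (simp add: class_A_def)
  show "starlike_quotient ?g z = starlike_quotient f (complex_of_real r * z)"
    if "z \<in> unit_disc" for z
    using DERIV_imp_deriv[OF der[OF that]] assms by (simp add: starlike_quotient_def)
qed

lemma phi_0_square: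
  assumes "z \<noteq> 1"
  shows "(phi_0 z)\<^sup>2 - 1 = 4 * z / (1 - z)\<^sup>2"
  using assms by (simp add: phi_0_def power_divide divide_simps) (simp add: power2_eq_square algebra_simps)

lemma Re_phi_0_pos:
  assumes "cmod z < 1"
  shows "Re (phi_0 z) > 0"
proof -
  have "phi_0 z = (1 + z) * cnj (1 - z) / of_real ((cmod (1 - z))\<^sup>2)"
    unfolding phi_0_def by (rule complex_div_cnj[THEN trans]) simp
  moreover have "Re ((1 + z) * cnj (1 - z)) = 1 - (cmod z)\<^sup>2"
    by (simp add: cmod_power2) (simp add: power2_eq_square algebra_simps)
  ultimately have "Re (phi_0 z) = (1 - (cmod z)\<^sup>2) / (cmod (1 - z))\<^sup>2"
    by (simp add: Re_divide_of_real)
  moreover have "(cmod z)\<^sup>2 < 1"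
    using assms by (simp add: abs_square_less_1)
  moreover have "z \<noteq> 1" using assms by auto
  ultimately show ?thesis by simp
qed

text \<open>The principal root of w^2 is w itself rather than -w because w lies in the right
  half-plane.\<close>

lemma phi_0_eq_phi_L:
  assumes "cmod z < 1"
  shows "phi_0 z = phi_L ((phi_0 z)\<^sup>2 - 1)"
  unfolding phi_L_def using Re_phi_0_pos[OF assms] by (simp add: csqrt_square)

lemma critical_radius_bounds: "0 < 3 - 2 * sqrt 2" "3 - 2 * sqrt 2 < (1::real)"
proof -
  have "sqrt 2 < 3 / 2"
    by (rule real_less_lsqrt) (auto simp: power2_eq_square)
  then show "0 < 3 - 2 * sqrt 2" by simp
qed simp

text \<open>The equation amounts to r^2 - 6 r + 1 = 0, of which this is the root below 1.\<close>

lemma critical_radius_eq: "4 * (3 - 2 * sqrt 2) = (1 - (3 - 2 * sqrt 2))\<^sup>2"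
  by (simp add: power2_eq_square algebra_simps)

text \<open>Bound 4 z / (1 - z)^2: with R the critical radius, the numerator has modulus below 4 R,
  the denominator modulus above (1 - R)^2, and these two bounds coincide.\<close>

lemma norm_phi_0_square_less:
  assumes "cmod z < 3 - 2 * sqrt 2"
  shows "cmod ((phi_0 z)\<^sup>2 - 1) < 1"
proof -
  let ?R = "3 - 2 * sqrt 2"
  have "1 - ?R < cmod (1 - z)"
    using assms norm_triangle_ineq2[of 1 z] by simp
  then have "(1 - ?R)\<^sup>2 < (cmod (1 - z))\<^sup>2"
    using critical_radius_bounds by (intro power_strict_mono) auto
  then have "4 * ?R < (cmod (1 - z))\<^sup>2"
    by (simp only: critical_radius_eq)
  with mult_strict_left_mono[OF assms, of 4] have "4 * cmod z < (cmod (1 - z))\<^sup>2"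
    by (rule less_trans) simp
  moreover have "z \<noteq> 1"
    using assms critical_radius_bounds by auto
  ultimately show ?thesis
    by (simp add: phi_0_square norm_mult norm_divide norm_power)
qed

lemma starlike_class_rescale:
  assumes "f \<in> starlike_class phi_0"
  shows "(\<lambda>z. f (complex_of_real (3 - 2 * sqrt 2) * z) / complex_of_real (3 - 2 * sqrt 2))
    \<in> starlike_class phi_L"
proof -
  define r where "r = 3 - 2 * sqrt 2"
  let ?g = "\<lambda>z. f (complex_of_real r * z) / complex_of_real r"
  have r: "0 < r" "r \<le> 1"
    using critical_radius_bounds by (auto simp: r_def)
  have f: "f \<in> class_A" "\<And>z. z \<in> unit_disc - {0} \<Longrightarrow> f z \<noteq> 0"
    using assms by (auto simp: starlike_class_def)
  obtain \<omega> where \<omega>: "\<omega> holomorphic_on unit_disc" "\<omega> ` unit_disc \<subseteq> unit_disc" "\<omega> 0 = 0"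
    and q: "\<And>z. z \<in> unit_disc \<Longrightarrow> starlike_quotient f z = phi_0 (\<omega> z)"
    using assms by (auto simp: starlike_class_def subordinate_def)
  have rz: "complex_of_real r * z \<in> unit_disc" if "z \<in> unit_disc" for z
    by (rule mult_mem_unit_disc[OF r that])
  \<comment> \<open>Schwarz alone gives a weak inequality; it becomes strict because |z| < 1. Hence
    the critical radius itself is admissible, not only smaller ones.\<close>
  have small: "cmod (\<omega> (complex_of_real r * z)) < r" if "z \<in> unit_disc" for z
  proof -
    have "cmod (\<omega> (complex_of_real r * z)) \<le> cmod (complex_of_real r * z)"
      using \<omega> rz[OF that] by (intro Schwarz_Lemma(1)) (auto simp: image_subset_iff)
    also have "\<dots> < r"
      using that r by (simp add: norm_mult)
    finally show ?thesis .
  qed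
  \<comment> \<open>The choice is forced: squaring w = \<open>csqrt\<close> (1 + \<psi>) leaves only
    \<psi> = w^2 - 1.\<close>
  define \<psi> where "\<psi> = (\<lambda>z. (phi_0 (\<omega> (complex_of_real r * z)))\<^sup>2 - 1)"
  have hol: "(\<lambda>z. phi_0 (\<omega> (complex_of_real r * z))) holomorphic_on unit_disc"
  proof -
    have "(\<lambda>z. \<omega> (complex_of_real r * z)) holomorphic_on unit_disc"
      using \<omega>(1) rz
      by (intro holomorphic_on_compose_gen[of "\<lambda>z. complex_of_real r * z" _ \<omega>, unfolded o_def])
        (auto intro!: holomorphic_intros)
    moreover have "\<omega> (complex_of_real r * z) \<in> unit_disc" if "z \<in> unit_disc" for z
      using \<omega>(2) rz[OF that] by blast
    ultimately show ?thesis
      by (intro holomorphic_on_compose_gen[OF _ phi_0_admissible(1), unfolded o_def]) auto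
  qed
  have "subordinate (starlike_quotient ?g) phi_L"
    unfolding subordinate_def
  proof (intro exI[of _ \<psi>] conjI ballI)
    show "\<psi> holomorphic_on unit_disc"
      unfolding \<psi>_def by (intro holomorphic_intros hol)
    show "\<psi> ` unit_disc \<subseteq> unit_disc"
      using small norm_phi_0_square_less by (auto simp: \<psi>_def r_def)
    show "\<psi> 0 = 0"
      using \<omega>(3) by (simp add: \<psi>_def phi_0_def)
    show "starlike_quotient ?g z = phi_L (\<psi> z)" if "z \<in> unit_disc" for z
      using rescale_class_A(2)[OF f(1) r that] q[OF rz[OF that]] small[OF that] r
        phi_0_eq_phi_L[of "\<omega> (complex_of_real r * z)"]
      by (simp add: \<psi>_def)
  qed
  moreover have "?g z \<noteq> 0" if "z \<in> unit_disc - {0}" for z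
    using f(2)[of "complex_of_real r * z"] rz[of z] that r by simp
  ultimately show ?thesis
    using rescale_class_A(1)[OF f(1) r] by (simp add: starlike_class_def r_def)
qed

definition koebe :: "complex \<Rightarrow> complex" where
  "koebe z = z / (1 - z)\<^sup>2"

lemma has_field_derivative_koebe:
  assumes "z \<noteq> 1"
  shows "(koebe has_field_derivative (1 + z) / (1 - z) ^ 3) (at z)"
proof -
  have "1 - z \<noteq> 0" using assms by simp
  have "(koebe has_field_derivative
      (1 * (1 - z)\<^sup>2 - z * (2 * (1 - z) * - 1)) / ((1 - z)\<^sup>2 * (1 - z)\<^sup>2)) (at z)"
    unfolding koebe_def using \<open>1 - z \<noteq> 0\<close>
    by (intro DERIV_divide) (auto intro!: derivative_eq_intros)
  also have "(1 * (1 - z)\<^sup>2 - z * (2 * (1 - z) * - 1)) / ((1 - z)\<^sup>2 * (1 - z)\<^sup>2) =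
      (1 + z) / (1 - z) ^ 3"
    using \<open>1 - z \<noteq> 0\<close> by (simp add: frac_eq_eq del: mult_minus_right) algebra
  finally show ?thesis .
qed

text \<open>Logarithmic differentiation of z / (1 - z)^2 gives 1 + 2 z / (1 - z), which is also the
  correct value 1 at the origin.\<close>

lemma starlike_quotient_koebe:
  assumes "z \<noteq> 1"
  shows "starlike_quotient koebe z = phi_0 z"
proof (cases "z = 0")
  case False
  have "1 - z \<noteq> 0" using assms by simp
  then show ?thesis
    using False DERIV_imp_deriv[OF has_field_derivative_koebe[OF assms]]
    by (simp add: starlike_quotient_def phi_0_def koebe_def power2_eq_square power3_eq_cube)
qed (simp add: starlike_quotient_def phi_0_def)

lemma koebe_starlike: "koebe \<in> starlike_class phi_0"
proof -
  have ne: "z \<noteq> 1" if "z \<in> unit_disc" for z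
    using that by auto
  have "koebe holomorphic_on unit_disc"
    using has_field_derivative_koebe ne by (subst holomorphic_on_open) blast+
  moreover have "deriv koebe 0 = 1"
    using DERIV_imp_deriv[OF has_field_derivative_koebe[of 0]] by simp
  moreover have "subordinate (starlike_quotient koebe) phi_0"
    unfolding subordinate_def
    by (rule exI[of _ "\<lambda>z. z"]) (use ne starlike_quotient_koebe in auto)
  ultimately show ?thesis
    using ne by (auto simp: starlike_class_def class_A_def koebe_def simp del: mem_ball)
qed

text \<open>The equality case of the bound above: at a positive real point |1 - z| = 1 - |z|, so the
  value reaches the unit circle. Here \<open>phi_0\<close> equals the square root of 2.\<close>

lemma phi_0_critical_radius: "(phi_0 (complex_of_real (3 - 2 * sqrt 2)))\<^sup>2 - 1 = 1"
proof -
  let ?R = "3 - 2 * sqrt 2"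
  have "(phi_0 (complex_of_real ?R))\<^sup>2 - 1 = 4 * complex_of_real ?R / (1 - complex_of_real ?R)\<^sup>2"
    using critical_radius_bounds by (intro phi_0_square) (metis less_irrefl of_real_eq_1_iff)
  also have "\<dots> = complex_of_real (4 * ?R / (1 - ?R)\<^sup>2)"
    by simp
  also have "4 * ?R / (1 - ?R)\<^sup>2 = 1"
    using critical_radius_eq critical_radius_bounds by (metis div_self less_numeral_extra(3) mult_pos_pos zero_less_numeral)
  finally show ?thesis by simp
qed

lemma koebe_rescale_bound:
  assumes r: "0 < r" "r \<le> 1"
    and mem: "(\<lambda>z. koebe (complex_of_real r * z) / complex_of_real r) \<in> starlike_class phi_L"
  shows "r \<le> 3 - 2 * sqrt 2"
proof (rule ccontr)
  let ?R = "3 - 2 * sqrt 2" and ?g = "\<lambda>z. koebe (complex_of_real r * z) / complex_of_real r"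
  assume "\<not> r \<le> ?R"
  \<comment> \<open>If r exceeds the critical radius, this point lies in the disc and scaling by r
    sends it to the critical radius.\<close>
  define z where "z = complex_of_real (?R / r)"
  have z: "z \<in> unit_disc"
    using \<open>\<not> r \<le> ?R\<close> r critical_radius_bounds by (simp add: z_def norm_divide del: of_real_diff of_real_divide)
  have rz: "complex_of_real r * z = complex_of_real ?R"
    using r by (simp add: z_def)
  obtain \<omega> where "\<omega> z \<in> unit_disc" and q: "starlike_quotient ?g z = phi_L (\<omega> z)"
    using mem z unfolding starlike_class_def subordinate_def by blast
  have "koebe \<in> class_A"
    using koebe_starlike by (simp add: starlike_class_def)
  then have "phi_L (\<omega> z) = starlike_quotient koebe (complex_of_real ?R)"
    using q rescale_class_A(2)[OF _ r z] rz by metis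
  also have "\<dots> = phi_0 (complex_of_real ?R)"
    using critical_radius_bounds by (intro starlike_quotient_koebe) (metis less_irrefl of_real_eq_1_iff)
  \<comment> \<open>Squaring removes the root, so \<omega> would have to take the boundary value 1
    inside the open disc.\<close>
  finally have "(phi_L (\<omega> z))\<^sup>2 - 1 = 1"
    using phi_0_critical_radius by simp
  then have "\<omega> z = 1"
    by (simp add: phi_L_def)
  with \<open>\<omega> z \<in> unit_disc\<close> show False by simp
qed

theorem theorem7p13: "class_radius phi_L phi_0 = 3 - 2 * sqrt 2"
  unfolding class_radius_def
\<comment> \<open>The supremum is attained, and the upper bound needs only the single test function
  \<open>koebe\<close>.\<close>
proof (rule cSup_eq_maximum)
  show "3 - 2 * sqrt 2 \<in> {r. 0 < r \<and> r \<le> 1 \<and> (\<forall>f\<in>starlike_class phi_0.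
      (\<lambda>z. f (complex_of_real r * z) / complex_of_real r) \<in> starlike_class phi_L)}"
    using starlike_class_rescale critical_radius_bounds by (simp del: of_real_diff)
qed (use koebe_rescale_bound koebe_starlike in blast)

end
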